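(* A graph $G$ is good if and only if $G$ has no induced subgraph isomorphic to any of: the gem; the graph $C_4+K_1$ with an added universal vertex; the local complement of the latter graph with respect to its universal vertex; the graph $3K_2$ with an added universal vertex; the octahedron with an added universal vertex.
   Context: Graphs are finite and simple. A threshold graph is a graph in which every induced subgraph has an isolated vertex or a universal vertex. The union of two vertex-disjoint graphs is their disjoint union; their join is the union plus all edges between the two vertex sets. A vertex $x$ of $G$ is good if the subgraph induced by its open neighborhood $N(x)$ is empty (i.e. $N(x)=\varnothing$), or a threshold graph, or the union of two threshold graphs, or the join of two threshold graphs. $G$ is good if every vertex is good. Local complementation at $x$ replaces the subgraph induced by $N(x)$ by its complement. The gem is $P_4$ plus a vertex adjacent to all its vertices; $C_4+K_1$ is a 4-cycle plus an isolated vertex; $3K_2$ is three disjoint edges; the octahedron is $K_{2,2,2}$; "with an added universal vertex" means adding a new vertex adjacent to all vertices. *)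

theory Defs
  imports "Graph_Theory.Graph_Theory"
begin

text \<open>
  A finite simple graph is a \<^locale>\<open>pair_graph\<close>: a finite vertex set with a symmetric, irreflexive
  set of arcs, so an undirected edge \<open>uv\<close> is the pair of arcs \<open>(u, v)\<close>, \<open>(v, u)\<close>.
  Induced subgraphs and isomorphism are the library notions, applied through \<^const>\<open>with_proj\<close>.
\<close>

definition pinduce :: "'a pair_pre_digraph \<Rightarrow> 'a set \<Rightarrow> 'a pair_pre_digraph" where
  "pinduce G S = \<lparr>pverts = S, parcs = {(u, v) \<in> parcs G. u \<in> S \<and> v \<in> S}\<rparr>"

lemma with_proj_pinduce: "with_proj (pinduce G S) = with_proj G \<restriction> S"
  by (auto simp: pinduce_def with_proj_def induce_subgraph_def)

definition nbhd :: "'a pair_pre_digraph \<Rightarrow> 'a \<Rightarrow> 'a set" where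
  "nbhd G x = {y. (x, y) \<in> parcs G}"

definition isolated_vertex :: "'a pair_pre_digraph \<Rightarrow> 'a \<Rightarrow> bool" where
  "isolated_vertex G x \<longleftrightarrow> x \<in> pverts G \<and> nbhd G x = {}"

definition universal_vertex :: "'a pair_pre_digraph \<Rightarrow> 'a \<Rightarrow> bool" where
  "universal_vertex G x \<longleftrightarrow> x \<in> pverts G \<and> nbhd G x = pverts G - {x}"

text \<open>
  Only induced subgraphs with at least one vertex are required to have an isolated or universal
  vertex; otherwise no graph at all would be threshold.
\<close>

definition threshold_graph :: "'a pair_pre_digraph \<Rightarrow> bool" where
  "threshold_graph G \<longleftrightarrow> pair_graph G \<and>
     (\<forall>H. induced_subgraph (with_proj H) (with_proj G) \<and> pverts H \<noteq> {} \<longrightarrow>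
        (\<exists>x. isolated_vertex H x \<or> universal_vertex H x))"

text \<open>Union and join are used only for vertex-disjoint graphs.\<close>

definition graph_union :: "'a pair_pre_digraph \<Rightarrow> 'a pair_pre_digraph \<Rightarrow> 'a pair_pre_digraph" where
  "graph_union G H = \<lparr>pverts = pverts G \<union> pverts H, parcs = parcs G \<union> parcs H\<rparr>"

lemma with_proj_graph_union: "with_proj (graph_union G H) = union (with_proj G) (with_proj H)"
  by (simp add: graph_union_def with_proj_def union_def)

definition graph_join :: "'a pair_pre_digraph \<Rightarrow> 'a pair_pre_digraph \<Rightarrow> 'a pair_pre_digraph" where
  "graph_join G H = \<lparr>pverts = pverts G \<union> pverts H,
     parcs = parcs G \<union> parcs H \<union> pverts G \<times> pverts H \<union> pverts H \<times> pverts G\<rparr>"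

definition good_vertex :: "'a pair_pre_digraph \<Rightarrow> 'a \<Rightarrow> bool" where
  "good_vertex G x \<longleftrightarrow>
     nbhd G x = {} \<or>
     threshold_graph (pinduce G (nbhd G x)) \<or>
     (\<exists>A B. threshold_graph A \<and> threshold_graph B \<and> pverts A \<inter> pverts B = {} \<and>
        pinduce G (nbhd G x) = graph_union A B) \<or>
     (\<exists>A B. threshold_graph A \<and> threshold_graph B \<and> pverts A \<inter> pverts B = {} \<and>
        pinduce G (nbhd G x) = graph_join A B)"

definition good_graph :: "'a pair_pre_digraph \<Rightarrow> bool" where
  "good_graph G \<longleftrightarrow> (\<forall>x \<in> pverts G. good_vertex G x)"

definition graph_complement :: "'a pair_pre_digraph \<Rightarrow> 'a pair_pre_digraph" where
  "graph_complement G = \<lparr>pverts = pverts G,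
     parcs = {(u, v). u \<in> pverts G \<and> v \<in> pverts G \<and> u \<noteq> v \<and> (u, v) \<notin> parcs G}\<rparr>"

definition local_complement :: "'a pair_pre_digraph \<Rightarrow> 'a \<Rightarrow> 'a pair_pre_digraph" where
  "local_complement G x = \<lparr>pverts = pverts G,
     parcs = (parcs G - parcs (pinduce G (nbhd G x))) \<union>
             parcs (graph_complement (pinduce G (nbhd G x)))\<rparr>"

definition single_vertex :: "'a \<Rightarrow> 'a pair_pre_digraph" where
  "single_vertex u = \<lparr>pverts = {u}, parcs = {}\<rparr>"

text \<open>Here \<open>u\<close> is meant to be a new vertex, not in \<open>G\<close>.\<close>

definition add_universal :: "'a \<Rightarrow> 'a pair_pre_digraph \<Rightarrow> 'a pair_pre_digraph" where
  "add_universal u G = graph_join G (single_vertex u)"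

definition graph_of_edges :: "'a set \<Rightarrow> ('a \<times> 'a) set \<Rightarrow> 'a pair_pre_digraph" where
  "graph_of_edges V E = \<lparr>pverts = V, parcs = E \<union> E\<inverse>\<rparr>"

definition path4 :: "nat pair_pre_digraph" where
  "path4 = graph_of_edges {0, 1, 2, 3} {(0, 1), (1, 2), (2, 3)}"

definition cycle4 :: "nat pair_pre_digraph" where
  "cycle4 = graph_of_edges {0, 1, 2, 3} {(0, 1), (1, 2), (2, 3), (3, 0)}"

definition three_K2 :: "nat pair_pre_digraph" where
  "three_K2 = graph_of_edges {0, 1, 2, 3, 4, 5} {(0, 1), (2, 3), (4, 5)}"

text \<open>The complete tripartite graph with parts \<open>{0, 1}\<close>, \<open>{2, 3}\<close>, \<open>{4, 5}\<close>.\<close>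

definition octahedron :: "nat pair_pre_digraph" where
  "octahedron = graph_of_edges {0, 1, 2, 3, 4, 5}
     ({0, 1} \<times> {2, 3} \<union> {0, 1} \<times> {4, 5} \<union> {2, 3} \<times> {4, 5})"

definition gem :: "nat pair_pre_digraph" where
  "gem = add_universal 4 path4"

definition C4_K1_universal :: "nat pair_pre_digraph" where
  "C4_K1_universal = add_universal 5 (graph_union cycle4 (single_vertex 4))"

definition has_induced_copy :: "'a pair_pre_digraph \<Rightarrow> 'b pair_pre_digraph \<Rightarrow> bool" where
  "has_induced_copy G F \<longleftrightarrow>
     (\<exists>H. induced_subgraph (with_proj H) (with_proj G) \<and> digraph_iso (with_proj H) (with_proj F))"

end

theory Submission
  imports Defs
begin

text \<open>
  A graph is threshold iff it has no alternating 4-cycle, i.e. no induced \<open>P\<^sub>4\<close>, \<open>C\<^sub>4\<close> or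
  \<open>2K\<^sub>2\<close>. In the neighbourhood of a vertex the five graphs of the theorem become \<open>P\<^sub>4\<close>,
  \<open>C\<^sub>4 + K\<^sub>1\<close>, \<open>3K\<^sub>2\<close> and the complements of the last two; this list is closed under
  complementation, which exchanges unions and joins. So if the neighbourhood avoids the list and
  is not threshold, it may be assumed to contain an induced \<open>2K\<^sub>2\<close>, with edges \<open>ab\<close> and \<open>cd\<close>.
  Two disjoint non-adjacent edges never lie in the same component: by \<open>P\<^sub>4\<close>-freeness a path
  between them would give a common neighbour of all four ends, hence the complement of
  \<open>C\<^sub>4 + K\<^sub>1\<close>. Therefore the component \<open>A\<close> of \<open>a\<close> is \<open>2K\<^sub>2\<close>-free, and so is the rest \<open>B\<close>,
  since \<open>ab\<close> would complete a \<open>2K\<^sub>2\<close> in \<open>B\<close> to a \<open>3K\<^sub>2\<close>. Neither part contains a \<open>C\<^sub>4\<close>, because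
  a vertex of the other part would complete it to \<open>C\<^sub>4 + K\<^sub>1\<close>. Hence both parts are threshold.
\<close>

section \<open>Obstructions in symmetric irreflexive relations\<close>

definition co_adj :: "('a \<Rightarrow> 'a \<Rightarrow> bool) \<Rightarrow> 'a \<Rightarrow> 'a \<Rightarrow> bool" where
  "co_adj E u v \<longleftrightarrow> u \<noteq> v \<and> \<not> E u v"

text \<open>The pairs \<open>a d\<close> and \<open>b c\<close> are left open, so one pattern covers
  induced P4, C4 and 2K2. For symmetric \<open>E\<close>, \<open>a = d\<close> or
  \<open>b = c\<close> would make \<open>a c\<close> an edge, so these need no separate
  exclusion.\<close>

definition alternating_free :: "('a \<Rightarrow> 'a \<Rightarrow> bool) \<Rightarrow> 'a set \<Rightarrow> bool" where
  "alternating_free E V \<longleftrightarrow> (\<forall>a\<in>V. \<forall>b\<in>V. \<forall>c\<in>V. \<forall>d\<in>V.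
     E a b \<and> E c d \<and> a \<noteq> c \<and> b \<noteq> d \<longrightarrow> E a c \<or> E b d)"

text \<open>Either part may be empty, so threshold graphs are included. Applied to
  \<open>co_adj E\<close> it describes joins.\<close>

definition two_parts :: "('a \<Rightarrow> 'a \<Rightarrow> bool) \<Rightarrow> 'a set \<Rightarrow> bool" where
  "two_parts E V \<longleftrightarrow> (\<exists>A B. V = A \<union> B \<and> A \<inter> B = {} \<and>
     alternating_free E A \<and> alternating_free E B \<and> (\<forall>a\<in>A. \<forall>b\<in>B. \<not> E a b))"

text \<open>
  For symmetric irreflexive \<open>E\<close> the adjacencies listed below already force the named vertices to be
  distinct, except for the two diagonals of the 4-cycle.
\<close>

definition P4_in :: "('a \<Rightarrow> 'a \<Rightarrow> bool) \<Rightarrow> 'a set \<Rightarrow> bool" where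
  "P4_in E V \<longleftrightarrow> (\<exists>a\<in>V. \<exists>b\<in>V. \<exists>c\<in>V. \<exists>d\<in>V.
     E a b \<and> E b c \<and> E c d \<and> \<not> E a c \<and> \<not> E a d \<and> \<not> E b d)"

definition C4_K1_in :: "('a \<Rightarrow> 'a \<Rightarrow> bool) \<Rightarrow> 'a set \<Rightarrow> bool" where
  "C4_K1_in E V \<longleftrightarrow> (\<exists>a\<in>V. \<exists>b\<in>V. \<exists>c\<in>V. \<exists>d\<in>V. \<exists>e\<in>V.
     E a b \<and> E b c \<and> E c d \<and> E d a \<and> a \<noteq> c \<and> b \<noteq> d \<and> \<not> E a c \<and> \<not> E b d \<and>
     \<not> E e a \<and> \<not> E e b \<and> \<not> E e c \<and> \<not> E e d)"

definition three_K2_in :: "('a \<Rightarrow> 'a \<Rightarrow> bool) \<Rightarrow> 'a set \<Rightarrow> bool" where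
  "three_K2_in E V \<longleftrightarrow> (\<exists>a\<in>V. \<exists>b\<in>V. \<exists>c\<in>V. \<exists>d\<in>V. \<exists>e\<in>V. \<exists>f\<in>V.
     E a b \<and> E c d \<and> E e f \<and>
     \<not> E a c \<and> \<not> E a d \<and> \<not> E b c \<and> \<not> E b d \<and>
     \<not> E a e \<and> \<not> E a f \<and> \<not> E b e \<and> \<not> E b f \<and>
     \<not> E c e \<and> \<not> E c f \<and> \<not> E d e \<and> \<not> E d f)"

text \<open>P4 is self-complementary and listed once. The other two patterns come with their
  complements: the butterfly (two triangles sharing a vertex) and the octahedron.\<close>

definition obstruction_free :: "('a \<Rightarrow> 'a \<Rightarrow> bool) \<Rightarrow> 'a set \<Rightarrow> bool" where
  "obstruction_free E V \<longleftrightarrow> \<not> P4_in E V \<and> \<not> C4_K1_in E V \<and> \<not> C4_K1_in (co_adj E) V \<and>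
     \<not> three_K2_in E V \<and> \<not> three_K2_in (co_adj E) V"

section \<open>Passing to the complement\<close>

lemma symp_co_adj: "symp E \<Longrightarrow> symp (co_adj E)"
  by (auto simp: symp_def co_adj_def)

lemma irreflp_co_adj: "irreflp (co_adj E)"
  by (auto simp: irreflp_def co_adj_def)

lemma co_adj_co_adj: "irreflp E \<Longrightarrow> co_adj (co_adj E) = E"
  by (auto simp: irreflp_def co_adj_def fun_eq_iff)

text \<open>Complementation exchanges the edges and non-edges of an alternating 4-cycle, so it is
  again alternating. One implication suffices because complementing twice returns
  \<open>E\<close>.\<close>

lemma alternating_free_co_adj:
  assumes "irreflp E"
  shows "alternating_free (co_adj E) V \<longleftrightarrow> alternating_free E V"
proof -
  have "alternating_free E V \<Longrightarrow> alternating_free (co_adj E) V" for E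
    unfolding alternating_free_def co_adj_def by blast
  then show ?thesis
    using co_adj_co_adj[OF assms] by metis
qed

text \<open>The complement of the path \<open>a b c d\<close> is the path
  \<open>b d a c\<close>.\<close>

lemma P4_in_co_adj:
  assumes "symp E" "irreflp E"
  shows "P4_in (co_adj E) V \<longleftrightarrow> P4_in E V"
proof -
  have "P4_in (co_adj E) V" if "symp E" "irreflp E" "P4_in E V" for E
  proof -
    from \<open>P4_in E V\<close> obtain a b c d where
      V: "a \<in> V" "b \<in> V" "c \<in> V" "d \<in> V" and
      E: "E a b" "E b c" "E c d" "\<not> E a c" "\<not> E a d" "\<not> E b d"
      unfolding P4_in_def by blast
    have "co_adj E b d \<and> co_adj E d a \<and> co_adj E a c \<and>
        \<not> co_adj E b a \<and> \<not> co_adj E b c \<and> \<not> co_adj E d c"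
      using E sympD[OF \<open>symp E\<close>] irreflpD[OF \<open>irreflp E\<close>] unfolding co_adj_def by metis
    then show ?thesis
      unfolding P4_in_def using V by blast
  qed
  from this[of E] this[of "co_adj E"] show ?thesis
    using assms symp_co_adj irreflp_co_adj co_adj_co_adj by metis
qed

lemma obstruction_free_co_adj:
  assumes "symp E" "irreflp E"
  shows "obstruction_free (co_adj E) V \<longleftrightarrow> obstruction_free E V"
  unfolding obstruction_free_def co_adj_co_adj[OF assms(2)] P4_in_co_adj[OF assms] by blast

text \<open>No edge joins the parts, so connected pieces stay in one of them. Every obstruction
  thereby puts an alternating 4-cycle inside a single part.\<close>

lemma two_parts_imp_obstruction_free:
  assumes sym: "symp E" and "two_parts E V"
  shows "obstruction_free E V"
proof -
  obtain A B where V: "V = A \<union> B" "A \<inter> B = {}"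
    and A: "alternating_free E A" and B: "alternating_free E B"
    and cross: "\<And>a b. a \<in> A \<Longrightarrow> b \<in> B \<Longrightarrow> \<not> E a b"
    using \<open>two_parts E V\<close> unfolding two_parts_def by blast
  note sym = sympD[OF sym]
  have side: "u \<in> A \<longleftrightarrow> v \<in> A" if "E u v" "u \<in> V" "v \<in> V" for u v
    using that cross V sym by blast
  have alt: False
    if "a \<in> V" "b \<in> V" "c \<in> V" "d \<in> V" "E a b" "E c d" "a \<in> A \<longleftrightarrow> c \<in> A"
      "a \<noteq> c" "b \<noteq> d" "\<not> E a c" "\<not> E b d" for a b c d
  proof (cases "a \<in> A")
    case True
    with that have "b \<in> A" "c \<in> A" "d \<in> A" using side by metis+
    with A True that show False unfolding alternating_free_def by blast
  next
    case False
    with that have "b \<notin> A" "c \<notin> A" "d \<notin> A" using side by metis+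
    with False that V have "a \<in> B" "b \<in> B" "c \<in> B" "d \<in> B" by blast+
    with B that show False unfolding alternating_free_def by blast
  qed
  have "\<not> P4_in E V"
  proof
    assume "P4_in E V"
    then obtain a b c d where
      v: "a \<in> V" "b \<in> V" "c \<in> V" "d \<in> V" and
      E: "E a b" "E b c" "E c d" "\<not> E a c" "\<not> E a d" "\<not> E b d"
      unfolding P4_in_def by blast
    show False
      using alt[OF v] E side[OF E(1)] side[OF E(2)] v sym by metis
  qed
  moreover have "\<not> C4_K1_in E V"
  proof
    assume "C4_K1_in E V"
    then obtain a b c d where
      v: "a \<in> V" "b \<in> V" "c \<in> V" "d \<in> V" and
      E: "E a b" "E b c" "E c d" "a \<noteq> c" "b \<noteq> d" "\<not> E a c" "\<not> E b d"
      unfolding C4_K1_in_def by blast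
    show False
      using alt[OF v] E side[OF E(1)] side[OF E(2)] v by blast
  qed
  moreover have "\<not> C4_K1_in (co_adj E) V"
  proof
    assume "C4_K1_in (co_adj E) V"
    then obtain a b c d e where
      v: "a \<in> V" "b \<in> V" "c \<in> V" "d \<in> V" "e \<in> V" and
      co: "co_adj E a b" "co_adj E b c" "co_adj E c d" "co_adj E d a"
        "\<not> co_adj E a c" "\<not> co_adj E b d" "a \<noteq> c" "b \<noteq> d"
        "\<not> co_adj E e a" "\<not> co_adj E e b" "\<not> co_adj E e c" "\<not> co_adj E e d"
      unfolding C4_K1_in_def by blast
    \<comment> \<open>In terms of \<open>E\<close> this is the butterfly: edges \<open>a c\<close>
      and \<open>b d\<close> with hub \<open>e\<close>, which puts both edges in the same
      part.\<close>
    then have E: "E a c" "E b d" "a \<noteq> b" "c \<noteq> d" "\<not> E a b" "\<not> E c d" "E e a" "E e b"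
      using sym unfolding co_adj_def by metis+
    show False
      using alt[of a c b d] E side[OF E(7)] side[OF E(8)] v by blast
  qed
  moreover have "\<not> three_K2_in E V"
  proof
    assume "three_K2_in E V"
    then obtain a b c d e f where
      v: "a \<in> V" "b \<in> V" "c \<in> V" "d \<in> V" "e \<in> V" "f \<in> V" and
      E: "E a b" "E c d" "E e f" "\<not> E a c" "\<not> E b d" "\<not> E a e" "\<not> E b f" "\<not> E c e" "\<not> E d f"
         "\<not> E a d" "\<not> E a f" "\<not> E c f" "\<not> E b c" "\<not> E b e" "\<not> E d e"
      unfolding three_K2_in_def by blast
    have "a \<noteq> c" "b \<noteq> d" "a \<noteq> e" "b \<noteq> f" "c \<noteq> e" "d \<noteq> f"
      using E sym by metis+
    \<comment> \<open>Two of \<open>a\<close>, \<open>c\<close>, \<open>e\<close> are in the same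
      part.\<close>
    then show False
      using alt[of a b c d] alt[of a b e f] alt[of c d e f] E v by blast
  qed
  moreover have "\<not> three_K2_in (co_adj E) V"
  proof
    assume "three_K2_in (co_adj E) V"
    then obtain a b c d e f where
      v: "a \<in> V" "b \<in> V" "c \<in> V" "d \<in> V" "e \<in> V" "f \<in> V" and
      co: "co_adj E a b" "co_adj E c d" "co_adj E e f" "\<not> co_adj E a c" "\<not> co_adj E b d"
         "\<not> co_adj E a d" "\<not> co_adj E b c" "\<not> co_adj E a e" "\<not> co_adj E b e"
         "\<not> co_adj E c e" "\<not> co_adj E d e" "\<not> co_adj E a f" "\<not> co_adj E b f"
      unfolding three_K2_in_def by blast
    then have ne: "a \<noteq> b" "c \<noteq> d" "e \<noteq> f" "a \<noteq> c" "b \<noteq> d" "a \<noteq> d" "b \<noteq> c"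
      using sym unfolding co_adj_def by metis+
    \<comment> \<open>\<open>a c b d\<close> is a 4-cycle of the octahedron with missing diagonals
      \<open>a b\<close> and \<open>c d\<close>; being connected, it lies in one part.\<close>
    then have E: "E a c" "E b d" "E a d" "E b c" "\<not> E a b" "\<not> E c d"
      using co unfolding co_adj_def by blast+
    show False
      using alt[of a c b d] E ne side[OF E(1)] side[OF E(4)] v by blast
  qed
  ultimately show ?thesis
    unfolding obstruction_free_def by blast
qed

text \<open>
  In a \<open>P\<^sub>4\<close>-free graph the vertices at distance at most 2 from \<open>a\<close> already form the component
  of \<open>a\<close>: a vertex at distance 3 would close an induced \<open>P\<^sub>4\<close>.
\<close>

definition near :: "('a \<Rightarrow> 'a \<Rightarrow> bool) \<Rightarrow> 'a set \<Rightarrow> 'a \<Rightarrow> 'a \<Rightarrow> bool" where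
  "near E V a v \<longleftrightarrow> v = a \<or> E a v \<or> (\<exists>z\<in>V. E a z \<and> E z v)"

lemma near_sym: "symp E \<Longrightarrow> near E V a v \<Longrightarrow> near E V v a"
  unfolding near_def by (meson sympD)

lemma near_step:
  assumes "symp E" "\<not> P4_in E V" "a \<in> V" "v \<in> V" "w \<in> V" "near E V a v" "E v w"
  shows "near E V a w"
  using assms unfolding near_def P4_in_def by (metis sympD)

text \<open>The second \<open>near\<close> spans at most two edges, each absorbed by
  \<open>near_step\<close>.\<close>

lemma near_trans:
  assumes "symp E" "\<not> P4_in E V" "a \<in> V" "v \<in> V" "w \<in> V" "near E V a v" "near E V v w"
  shows "near E V a w"
  using assms near_step unfolding near_def[of E V v w] by metis

lemma two_K2_imp_two_parts:
  assumes sym: "symp E" and irr: "irreflp E" and free: "obstruction_free E V"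
    and V: "a \<in> V" "b \<in> V" "c \<in> V" "d \<in> V"
    and E: "E a b" "E c d" "\<not> E a c" "\<not> E a d" "\<not> E b c" "\<not> E b d"
  shows "two_parts E V"
proof -
  note s = sympD[OF sym] and i = irreflpD[OF irr]
  have P4: "\<not> P4_in E V" and C4K1: "\<not> C4_K1_in E V"
    and butterfly: "\<not> C4_K1_in (co_adj E) V" and K2: "\<not> three_K2_in E V"
    using free unfolding obstruction_free_def by blast+
  have far: "\<not> near E V p r"
    if v: "p \<in> V" "q \<in> V" "r \<in> V" "s \<in> V"
      and e: "E p q" "E r s" "\<not> E p r" "\<not> E p s" "\<not> E q r" "\<not> E q s" for p q r s
  proof
    assume "near E V p r"
    moreover have ne: "p \<noteq> r" "p \<noteq> s" "q \<noteq> r" "q \<noteq> s"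
      using e s by metis+
    ultimately obtain z where z: "z \<in> V" "E p z" "E z r"
      using e unfolding near_def by blast
    \<comment> \<open>Otherwise \<open>q p z r\<close> or \<open>p z r s\<close> would be an induced
      P4. Hence \<open>z\<close> is the hub of a butterfly; in the complement the 4-cycle is
      \<open>p r q s\<close> and \<open>z\<close> is isolated from it.\<close>
    have "E q z" "E z s"
      using P4 v z e s unfolding P4_in_def by metis+
    then have "co_adj E p r \<and> co_adj E r q \<and> co_adj E q s \<and> co_adj E s p \<and>
        p \<noteq> q \<and> r \<noteq> s \<and> \<not> co_adj E p q \<and> \<not> co_adj E r s \<and>
        \<not> co_adj E z p \<and> \<not> co_adj E z r \<and> \<not> co_adj E z q \<and> \<not> co_adj E z s"
      using e ne z s i unfolding co_adj_def by metis
    with butterfly v z(1) show False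
      unfolding C4_K1_in_def by blast
  qed
  define A where "A = {v \<in> V. near E V a v}"
  define B where "B = V - A"
  have cross: "\<not> E u v" if "u \<in> A" "v \<in> B" for u v
    using that near_step[OF sym P4] V(1) unfolding A_def B_def by blast
  have aA: "a \<in> A" "b \<in> A"
    using V E unfolding A_def near_def by blast+
  have cB: "c \<in> B"
    using far[OF V E] V unfolding A_def B_def by blast
  have sub: "A \<subseteq> V" "B \<subseteq> V" "A \<union> B = V" "A \<inter> B = {}"
    unfolding A_def B_def by blast+
  \<comment> \<open>If exactly one of \<open>p s\<close> and \<open>q r\<close> were an edge, the
    four vertices would induce a P4; what remains is C4 or 2K2.\<close>
  have alt_cases: "(E p s \<and> E q r) \<or> (\<not> E p s \<and> \<not> E q r)"
    if "p \<in> V" "q \<in> V" "r \<in> V" "s \<in> V" "E p q" "E r s" "\<not> E p r" "\<not> E q s" for p q r s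
    using P4 that s unfolding P4_in_def by metis
  have no_C4: False
    if "p \<in> V" "q \<in> V" "r \<in> V" "s \<in> V" "E p q" "E r s" "p \<noteq> r" "q \<noteq> s"
      "\<not> E p r" "\<not> E q s" "E p s" "E q r"
      "e \<in> V" "\<not> E e p" "\<not> E e q" "\<not> E e r" "\<not> E e s" for p q r s e
    using C4K1 that s unfolding C4_K1_in_def by blast
  \<comment> \<open>The vertex \<open>c\<close> outside the component rules out a C4. A 2K2
    contradicts \<open>far\<close>, since \<open>p\<close> and \<open>r\<close> are both near
    \<open>a\<close> and hence near each other.\<close>
  have "alternating_free E A"
    unfolding alternating_free_def
  proof (intro ballI impI, rule ccontr)
    fix p q r s
    assume v: "p \<in> A" "q \<in> A" "r \<in> A" "s \<in> A"
      and e: "E p q \<and> E r s \<and> p \<noteq> r \<and> q \<noteq> s" and ne: "\<not> (E p r \<or> E q s)"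
    have vV: "p \<in> V" "q \<in> V" "r \<in> V" "s \<in> V" using v sub by blast+
    have "\<not> E c p" "\<not> E c q" "\<not> E c r" "\<not> E c s"
      using v cB cross s by blast+
    then have "\<not> (E p s \<and> E q r)"
      using no_C4[OF vV] V(3) e ne by blast
    then have "\<not> E p s" "\<not> E q r"
      using alt_cases[OF vV] e ne by blast+
    then have "\<not> near E V p r"
      using far[OF vV] e ne by blast
    moreover have "near E V p r"
      using v V(1) near_trans[OF sym P4 vV(1) V(1) vV(3)] near_sym[OF sym] unfolding A_def by blast
    ultimately show False by blast
  qed
  \<comment> \<open>Here \<open>a\<close> rules out a C4, and the edge \<open>a b\<close> extends a
    2K2 to a 3K2.\<close>
  moreover have "alternating_free E B"
    unfolding alternating_free_def
  proof (intro ballI impI, rule ccontr)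
    fix p q r s
    assume v: "p \<in> B" "q \<in> B" "r \<in> B" "s \<in> B"
      and e: "E p q \<and> E r s \<and> p \<noteq> r \<and> q \<noteq> s" and ne: "\<not> (E p r \<or> E q s)"
    have vV: "p \<in> V" "q \<in> V" "r \<in> V" "s \<in> V" using v sub by blast+
    have ab: "\<not> E a p" "\<not> E a q" "\<not> E a r" "\<not> E a s" "\<not> E b p" "\<not> E b q" "\<not> E b r" "\<not> E b s"
      using v aA cross by blast+
    then have "\<not> (E p s \<and> E q r)"
      using no_C4[OF vV] V(1) e ne by blast
    then have "\<not> E p s" "\<not> E q r"
      using alt_cases[OF vV] e ne by blast+
    then have "three_K2_in E V"
      unfolding three_K2_in_def using vV V(1,2) E(1) ab e ne by blast
    with K2 show False ..
  qed
  ultimately show ?thesis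
    unfolding two_parts_def using sub cross by metis
qed

lemma alternating_free_imp_two_parts:
  assumes "alternating_free E V"
  shows "two_parts E V"
  unfolding two_parts_def
  by (intro exI[of _ V] exI[of _ "{}"]) (use assms in \<open>auto simp: alternating_free_def\<close>)

text \<open>In a P4-free graph an alternating 4-cycle is a 2K2 or a C4, and a C4 is a 2K2 of the
  complement. So \<open>two_K2_imp_two_parts\<close> applies to \<open>E\<close> or to
  \<open>co_adj E\<close>.\<close>

lemma obstruction_free_imp_two_parts:
  assumes sym: "symp E" and irr: "irreflp E" and free: "obstruction_free E V"
  shows "two_parts E V \<or> two_parts (co_adj E) V"
proof (cases "alternating_free E V")
  case True
  then show ?thesis
    using alternating_free_imp_two_parts by blast
next
  case False
  note s = sympD[OF sym]
  from False obtain a b c d where V: "a \<in> V" "b \<in> V" "c \<in> V" "d \<in> V"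
    and E: "E a b" "E c d" "a \<noteq> c" "b \<noteq> d" "\<not> E a c" "\<not> E b d"
    unfolding alternating_free_def by blast
  have "\<not> P4_in E V"
    using free unfolding obstruction_free_def by blast
  then consider "\<not> E a d" "\<not> E b c" | "E a d" "E b c"
    using V E s unfolding P4_in_def by metis
  then show ?thesis
  proof cases
    case 1
    then show ?thesis
      using two_K2_imp_two_parts[OF assms V] E by blast
  next
    case 2
    \<comment> \<open>The diagonals \<open>a c\<close> and \<open>b d\<close> of the 4-cycle are the
      two complement edges, which explains the vertex order \<open>V(1,3,2,4)\<close>.\<close>
    have "co_adj E a c" "co_adj E b d" "\<not> co_adj E a b" "\<not> co_adj E a d"
      "\<not> co_adj E c b" "\<not> co_adj E c d"
      using E 2 s unfolding co_adj_def by blast+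
    moreover have "obstruction_free (co_adj E) V"
      using obstruction_free_co_adj[OF sym irr] free by blast
    ultimately show ?thesis
      using two_K2_imp_two_parts[OF symp_co_adj[OF sym] irreflp_co_adj _ V(1,3,2,4)] by blast
  qed
qed

lemma obstruction_free_iff_two_parts:
  assumes "symp E" "irreflp E"
  shows "obstruction_free E V \<longleftrightarrow> two_parts E V \<or> two_parts (co_adj E) V"
  using assms obstruction_free_imp_two_parts two_parts_imp_obstruction_free
    obstruction_free_co_adj symp_co_adj irreflp_co_adj by metis

section \<open>Threshold graphs and good vertices\<close>

lemma alternating_free_cong:
  assumes "\<And>u v. u \<in> V \<Longrightarrow> v \<in> V \<Longrightarrow> E u v \<longleftrightarrow> E' u v"
  shows "alternating_free E V \<longleftrightarrow> alternating_free E' V"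
  using assms unfolding alternating_free_def by simp

text \<open>If a vertex \<open>v\<close> of maximum degree is not universal, then every non-neighbour of \<open>v\<close> is isolated.\<close>

lemma alternating_free_imp_isolated_or_universal:
  assumes "symp E" "irreflp E" "finite T" "T \<noteq> {}" "alternating_free E T"
  shows "\<exists>v\<in>T. (\<forall>u\<in>T. \<not> E v u) \<or> (\<forall>u\<in>T. u \<noteq> v \<longrightarrow> E v u)"
proof -
  note s = sympD[OF assms(1)] and i = irreflpD[OF assms(2)]
  define N where "N v = {u \<in> T. E v u}" for v
  have fin: "finite (N v)" for v
    using \<open>finite T\<close> unfolding N_def by simp
  obtain v where v: "v \<in> T" and max: "\<And>w. w \<in> T \<Longrightarrow> card (N w) \<le> card (N v)"
  proof -
    have "Max ((card \<circ> N) ` T) \<in> (card \<circ> N) ` T"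
      using assms(3,4) by (intro Max_in) auto
    then obtain v where "v \<in> T" "Max ((card \<circ> N) ` T) = card (N v)"
      by auto
    moreover have "card (N w) \<le> Max ((card \<circ> N) ` T)" if "w \<in> T" for w
      using assms(3) that by (intro Max_ge) auto
    ultimately show ?thesis
      using that by metis
  qed
  have "\<forall>w\<in>T. \<not> E u w" if u: "u \<in> T" "u \<noteq> v" "\<not> E v u" for u
  proof (intro ballI notI)
    fix w assume w: "w \<in> T" "E u w"
    \<comment> \<open>Otherwise \<open>w\<close> would have larger degree than \<open>v\<close>,
      since \<open>u\<close> is a neighbour of \<open>w\<close> only. The edge \<open>v w\<close>,
      if present, is discarded once on each side.\<close>
    have "\<not> N v - {w} \<subseteq> N w - {v}"
    proof
      assume "N v - {w} \<subseteq> N w - {v}"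
      moreover have "u \<in> N w - {v}" "u \<notin> N v - {w}"
        using u w s unfolding N_def by auto
      ultimately have "card (N v - {w}) < card (N w - {v})"
        using fin by (intro psubset_card_mono) auto
      moreover have "w \<in> N v \<longleftrightarrow> v \<in> N w"
        using v w s unfolding N_def by auto
      ultimately show False
        using max[OF w(1)] fin by (cases "w \<in> N v") auto
    qed
    \<comment> \<open>The edges \<open>v x\<close>, \<open>u w\<close> and the non-edges
      \<open>v u\<close>, \<open>x w\<close> now alternate.\<close>
    then obtain x where "x \<in> T" "E v x" "x \<noteq> w" "\<not> E w x"
      using i unfolding N_def by blast
    then show False
      using assms(5) u w v s unfolding alternating_free_def by metis
  qed
  then show ?thesis
    using v by blast
qed

section \<open>From graphs to adjacency relations\<close>

lemma pair_graphI:
  assumes "finite (pverts G)" "parcs G \<subseteq> pverts G \<times> pverts G"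
    "\<And>u v. (u, v) \<in> parcs G \<Longrightarrow> (v, u) \<in> parcs G" "\<And>u. (u, u) \<notin> parcs G"
  shows "pair_graph G"
proof -
  have "finite (parcs G)"
    using assms(1,2) finite_subset by blast
  then show ?thesis
    using assms by unfold_locales (auto simp: symmetric_def intro!: symI)
qed

lemma threshold_graph_imp_pair_graph: "threshold_graph G \<Longrightarrow> pair_graph G"
  by (simp add: threshold_graph_def)

context pair_graph
begin

lemma parcs_subset: "parcs G \<subseteq> pverts G \<times> pverts G"
  using in_arcsD1 in_arcsD2 by auto

lemma symp_adj: "symp (\<lambda>u v. (u, v) \<in> parcs G)"
  using pair_sym_arcs by (auto simp: symmetric_def symp_def dest: symD)

lemma irreflp_adj: "irreflp (\<lambda>u v. (u, v) \<in> parcs G)"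
  using pair_no_loops by (force intro: irreflpI)

lemma pair_graph_pinduce: "S \<subseteq> pverts G \<Longrightarrow> pair_graph (pinduce G S)"
  using symp_adj irreflp_adj pair_finite_verts
  by (intro pair_graphI) (auto simp: pinduce_def symp_def irreflp_def intro: finite_subset)

text \<open>Turns quantification over induced subgraphs of the library into quantification over
  vertex sets.\<close>

lemma induced_subgraph_iff_pinduce:
  "induced_subgraph (with_proj H) (with_proj G) \<longleftrightarrow> (\<exists>S \<subseteq> pverts G. H = pinduce G S)"
proof
  assume "induced_subgraph (with_proj H) (with_proj G)"
  then have "pverts H \<subseteq> pverts G" "parcs H = parcs (pinduce G (pverts H))"
    by (auto simp: induced_subgraph_def subgraph_def pinduce_def)
  then show "\<exists>S \<subseteq> pverts G. H = pinduce G S"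
    by (intro exI[of _ "pverts H"]) (auto simp: pinduce_def)
next
  assume "\<exists>S \<subseteq> pverts G. H = pinduce G S"
  then obtain S where S: "S \<subseteq> pverts G" "H = pinduce G S" by blast
  then interpret H: pair_graph H using pair_graph_pinduce by blast
  show "induced_subgraph (with_proj H) (with_proj G)"
    using S wf_digraph H.wf_digraph
    by (auto simp: induced_subgraph_def subgraph_def pinduce_def compatible_def)
qed

text \<open>Each vertex of an alternating 4-cycle has a neighbour and a non-neighbour on it, so the
  subgraph induced there violates the definition. Conversely, being \<open>alternating_free\<close>
  passes to subsets, where \<open>alternating_free_imp_isolated_or_universal\<close>
  applies.\<close>

lemma threshold_graph_iff:
  "threshold_graph G \<longleftrightarrow> alternating_free (\<lambda>u v. (u, v) \<in> parcs G) (pverts G)"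
  (is "_ \<longleftrightarrow> alternating_free ?E _")
proof
  assume thr: "threshold_graph G"
  show "alternating_free ?E (pverts G)"
    unfolding alternating_free_def
  proof (intro ballI impI, rule ccontr)
    fix a b c d
    assume V: "a \<in> pverts G" "b \<in> pverts G" "c \<in> pverts G" "d \<in> pverts G"
      and E: "?E a b \<and> ?E c d \<and> a \<noteq> c \<and> b \<noteq> d" "\<not> (?E a c \<or> ?E b d)"
    define H where "H = pinduce G {a, b, c, d}"
    have "induced_subgraph (with_proj H) (with_proj G)" "pverts H \<noteq> {}"
      using V unfolding induced_subgraph_iff_pinduce H_def by (auto simp: pinduce_def)
    then obtain x where x: "isolated_vertex H x \<or> universal_vertex H x"
      using thr unfolding threshold_graph_def by blast
    then have "x \<in> {a, b, c, d}"
      by (auto simp: isolated_vertex_def universal_vertex_def H_def pinduce_def)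
    with x E show False
      using sympD[OF symp_adj]
      by (auto simp: isolated_vertex_def universal_vertex_def nbhd_def H_def pinduce_def)
  qed
next
  assume alt: "alternating_free ?E (pverts G)"
  show "threshold_graph G"
    unfolding threshold_graph_def
  proof (intro conjI allI impI)
    show "pair_graph G" by unfold_locales
  next
    fix H assume H: "induced_subgraph (with_proj H) (with_proj G) \<and> pverts H \<noteq> {}"
    then obtain S where S: "S \<subseteq> pverts G" "H = pinduce G S"
      unfolding induced_subgraph_iff_pinduce by blast
    then have "S \<noteq> {}"
      using H by (simp add: pinduce_def)
    have "alternating_free ?E S"
      using alt S(1) unfolding alternating_free_def by blast
    then obtain v where "v \<in> S" "(\<forall>u\<in>S. \<not> ?E v u) \<or> (\<forall>u\<in>S. u \<noteq> v \<longrightarrow> ?E v u)"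
      using alternating_free_imp_isolated_or_universal[OF symp_adj irreflp_adj
          finite_subset[OF S(1) pair_finite_verts] \<open>S \<noteq> {}\<close>] by blast
    then have "isolated_vertex H v \<or> universal_vertex H v"
      using S(2) irreflpD[OF irreflp_adj]
      by (auto simp: isolated_vertex_def universal_vertex_def nbhd_def pinduce_def)
    then show "\<exists>x. isolated_vertex H x \<or> universal_vertex H x" ..
  qed
qed

lemma threshold_graph_pinduce:
  assumes "S \<subseteq> pverts G"
  shows "threshold_graph (pinduce G S) \<longleftrightarrow> alternating_free (\<lambda>u v. (u, v) \<in> parcs G) S"
  unfolding pair_graph.threshold_graph_iff[OF pair_graph_pinduce[OF assms]]
  by (subst alternating_free_cong[where E' = "\<lambda>u v. (u, v) \<in> parcs G"])
    (auto simp: pinduce_def)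

text \<open>Disjointness keeps the arcs of one graph out of the other, so the graphs united are the
  subgraphs induced on their vertex sets.\<close>

lemma union_iff_two_parts:
  assumes S: "S \<subseteq> pverts G"
  shows "(\<exists>A B. threshold_graph A \<and> threshold_graph B \<and> pverts A \<inter> pverts B = {} \<and>
      pinduce G S = graph_union A B) \<longleftrightarrow> two_parts (\<lambda>u v. (u, v) \<in> parcs G) S"
    (is "?L \<longleftrightarrow> two_parts ?E S")
proof
  assume ?L
  then obtain A B where thr: "threshold_graph A" "threshold_graph B"
    and disj: "pverts A \<inter> pverts B = {}" and eq: "pinduce G S = graph_union A B"
    by blast
  then interpret A: pair_graph A + B: pair_graph B
    by (auto dest: threshold_graph_imp_pair_graph)
  have S_eq: "S = pverts A \<union> pverts B"
    using arg_cong[OF eq, of pverts] by (simp add: pinduce_def graph_union_def)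
  have arcs: "?E u v \<longleftrightarrow> (u, v) \<in> parcs A \<or> (u, v) \<in> parcs B" if "u \<in> S" "v \<in> S" for u v
    using arg_cong[OF eq, of parcs] that by (auto simp: pinduce_def graph_union_def)
  have "alternating_free ?E (pverts A)"
    using thr(1) disj B.parcs_subset arcs unfolding A.threshold_graph_iff S_eq
    by (subst alternating_free_cong[where E' = "\<lambda>u v. (u, v) \<in> parcs A"]) blast+
  moreover have "alternating_free ?E (pverts B)"
    using thr(2) disj A.parcs_subset arcs unfolding B.threshold_graph_iff S_eq
    by (subst alternating_free_cong[where E' = "\<lambda>u v. (u, v) \<in> parcs B"]) blast+
  moreover have "\<not> ?E a b" if "a \<in> pverts A" "b \<in> pverts B" for a b
    using arcs[of a b] that disj A.parcs_subset B.parcs_subset unfolding S_eq by blast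
  ultimately show "two_parts ?E S"
    unfolding two_parts_def using S_eq disj by blast
next
  assume "two_parts ?E S"
  then obtain A B where AB: "S = A \<union> B" "A \<inter> B = {}" "alternating_free ?E A"
    "alternating_free ?E B" "\<forall>a\<in>A. \<forall>b\<in>B. \<not> ?E a b"
    unfolding two_parts_def by blast
  then have "\<forall>a\<in>A. \<forall>b\<in>B. \<not> ?E a b \<and> \<not> ?E b a"
    using sympD[OF symp_adj] by blast
  then have "pinduce G S = graph_union (pinduce G A) (pinduce G B)"
    using AB(1) by (auto simp: pinduce_def graph_union_def)
  moreover have "threshold_graph (pinduce G A)" "threshold_graph (pinduce G B)"
    using threshold_graph_pinduce AB S by auto
  moreover have "pverts (pinduce G A) \<inter> pverts (pinduce G B) = {}"
    using AB by (simp add: pinduce_def)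
  ultimately show ?L by blast
qed

text \<open>A join is a union in the complement, and its parts stay threshold because
  \<open>alternating_free\<close> is invariant under complementation.\<close>

lemma join_iff_two_parts:
  assumes S: "S \<subseteq> pverts G"
  shows "(\<exists>A B. threshold_graph A \<and> threshold_graph B \<and> pverts A \<inter> pverts B = {} \<and>
      pinduce G S = graph_join A B) \<longleftrightarrow> two_parts (co_adj (\<lambda>u v. (u, v) \<in> parcs G)) S"
    (is "?L \<longleftrightarrow> two_parts (co_adj ?E) S")
proof
  assume ?L
  then obtain A B where thr: "threshold_graph A" "threshold_graph B"
    and disj: "pverts A \<inter> pverts B = {}" and eq: "pinduce G S = graph_join A B"
    by blast
  then interpret A: pair_graph A + B: pair_graph B
    by (auto dest: threshold_graph_imp_pair_graph)
  have S_eq: "S = pverts A \<union> pverts B"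
    using arg_cong[OF eq, of pverts] by (simp add: pinduce_def graph_join_def)
  have arcs: "?E u v \<longleftrightarrow> (u, v) \<in> parcs A \<or> (u, v) \<in> parcs B \<or>
      (u, v) \<in> pverts A \<times> pverts B \<or> (u, v) \<in> pverts B \<times> pverts A" if "u \<in> S" "v \<in> S" for u v
    using arg_cong[OF eq, of parcs] that by (auto simp: pinduce_def graph_join_def)
  have "alternating_free ?E (pverts A)"
    using thr(1) disj B.parcs_subset arcs unfolding A.threshold_graph_iff S_eq
    by (subst alternating_free_cong[where E' = "\<lambda>u v. (u, v) \<in> parcs A"]) blast+
  moreover have "alternating_free ?E (pverts B)"
    using thr(2) disj A.parcs_subset arcs unfolding B.threshold_graph_iff S_eq
    by (subst alternating_free_cong[where E' = "\<lambda>u v. (u, v) \<in> parcs B"]) blast+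
  moreover have "\<not> co_adj ?E a b" if "a \<in> pverts A" "b \<in> pverts B" for a b
    using arcs[of a b] that unfolding S_eq co_adj_def by blast
  ultimately show "two_parts (co_adj ?E) S"
    unfolding two_parts_def alternating_free_co_adj[OF irreflp_adj] using S_eq disj by blast
next
  assume "two_parts (co_adj ?E) S"
  then obtain A B where AB: "S = A \<union> B" "A \<inter> B = {}" "alternating_free ?E A"
    "alternating_free ?E B" "\<forall>a\<in>A. \<forall>b\<in>B. \<not> co_adj ?E a b"
    unfolding two_parts_def alternating_free_co_adj[OF irreflp_adj] by blast
  then have "\<forall>a\<in>A. \<forall>b\<in>B. ?E a b \<and> ?E b a"
    using sympD[OF symp_adj] unfolding co_adj_def by (metis disjoint_iff)
  then have "pinduce G S = graph_join (pinduce G A) (pinduce G B)"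
    using AB(1) by (auto simp: pinduce_def graph_join_def)
  moreover have "threshold_graph (pinduce G A)" "threshold_graph (pinduce G B)"
    using threshold_graph_pinduce AB S by auto
  moreover have "pverts (pinduce G A) \<inter> pverts (pinduce G B) = {}"
    using AB by (simp add: pinduce_def)
  ultimately show ?L by blast
qed

lemma nbhd_subset: "nbhd G x \<subseteq> pverts G"
  using parcs_subset by (auto simp: nbhd_def)

text \<open>An empty or threshold neighbourhood is the union case with one empty part, so only the
  union and the join alternatives remain.\<close>

lemma good_vertex_iff_obstruction_free:
  "good_vertex G x \<longleftrightarrow> obstruction_free (\<lambda>u v. (u, v) \<in> parcs G) (nbhd G x)"
  (is "_ \<longleftrightarrow> obstruction_free ?E ?N")
proof -
  have "alternating_free ?E ?N" if "?N = {}"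
    using that by (simp add: alternating_free_def)
  then show ?thesis
    using alternating_free_imp_two_parts[of ?E ?N]
    unfolding good_vertex_def obstruction_free_iff_two_parts[OF symp_adj irreflp_adj]
      union_iff_two_parts[OF nbhd_subset] join_iff_two_parts[OF nbhd_subset]
      threshold_graph_pinduce[OF nbhd_subset]
    by blast
qed

end

section \<open>Induced copies\<close>

text \<open>The target is a bare relation on a set, so that neighbourhoods and \<open>co_adj\<close>
  can be targets too.\<close>

definition embeds :: "('a \<Rightarrow> 'a \<Rightarrow> bool) \<Rightarrow> 'a set \<Rightarrow> 'b pair_pre_digraph \<Rightarrow> bool" where
  "embeds E V F \<longleftrightarrow> (\<exists>f. inj_on f (pverts F) \<and> f ` pverts F \<subseteq> V \<and>
     (\<forall>u\<in>pverts F. \<forall>v\<in>pverts F. E (f u) (f v) \<longleftrightarrow> (u, v) \<in> parcs F))"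

text \<open>Tail and head are the projections on both sides, so the arc map of an isomorphism is
  determined by its vertex map.\<close>

lemma (in pair_graph) has_induced_copy_iff_embeds:
  assumes F: "pair_graph F"
  shows "has_induced_copy G F \<longleftrightarrow> embeds (\<lambda>u v. (u, v) \<in> parcs G) (pverts G) F"
proof
  interpret F: pair_graph F by fact
  assume "has_induced_copy G F"
  then obtain S where S: "S \<subseteq> pverts G"
    and iso: "digraph_iso (with_proj (pinduce G S)) (with_proj F)"
    unfolding has_induced_copy_def induced_subgraph_iff_pinduce by blast
  interpret H: pair_graph "pinduce G S" using pair_graph_pinduce[OF S] .
  \<comment> \<open>The isomorphism is reversed so that it maps \<open>F\<close> onto the induced
    subgraph.\<close>
  obtain h where h: "F.digraph_isomorphism h"
    and eq: "with_proj (pinduce G S) = app_iso h (with_proj F)"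
    using digraph_iso_swap[OF H.wf_digraph iso] unfolding digraph_iso_def by blast
  let ?f = "iso_verts h"
  have verts: "S = ?f ` pverts F"
    using arg_cong[OF eq, of verts] by (simp add: pinduce_def)
  have arcs: "parcs (pinduce G S) = iso_arcs h ` parcs F"
    using arg_cong[OF eq, of arcs] by simp
  have tl: "iso_tail h = fst" "iso_head h = snd"
    using arg_cong[OF eq, of tail] arg_cong[OF eq, of head] by simp_all
  have inj: "inj_on ?f (pverts F)"
    using h by (simp add: F.digraph_isomorphism_def)
  have "iso_arcs h a = (?f (fst a), ?f (snd a))" if "a \<in> parcs F" for a
    using h that tl by (auto simp: F.digraph_isomorphism_def prod_eq_iff)
  then have arcs': "parcs (pinduce G S) = (\<lambda>a. (?f (fst a), ?f (snd a))) ` parcs F"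
    unfolding arcs by auto
  have "(?f u, ?f v) \<in> parcs G \<longleftrightarrow> (u, v) \<in> parcs F" if uv: "u \<in> pverts F" "v \<in> pverts F" for u v
  proof -
    have "(?f u, ?f v) \<in> parcs G \<longleftrightarrow> (?f u, ?f v) \<in> parcs (pinduce G S)"
      using uv verts by (auto simp: pinduce_def)
    also have "\<dots> \<longleftrightarrow> (\<exists>(u', v') \<in> parcs F. ?f u = ?f u' \<and> ?f v = ?f v')"
      unfolding arcs' by (force simp: image_iff)
    also have "\<dots> \<longleftrightarrow> (u, v) \<in> parcs F"
      using inj_onD[OF inj _ uv(1)] inj_onD[OF inj _ uv(2)] F.parcs_subset by blast
    finally show ?thesis .
  qed
  then show "embeds (\<lambda>u v. (u, v) \<in> parcs G) (pverts G) F"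
    unfolding embeds_def using inj verts S by blast
next
  interpret F: pair_graph F by fact
  assume "embeds (\<lambda>u v. (u, v) \<in> parcs G) (pverts G) F"
  then obtain f where f: "inj_on f (pverts F)" "f ` pverts F \<subseteq> pverts G"
    "\<And>u v. u \<in> pverts F \<Longrightarrow> v \<in> pverts F \<Longrightarrow> (f u, f v) \<in> parcs G \<longleftrightarrow> (u, v) \<in> parcs F"
    unfolding embeds_def by blast
  let ?H = "pinduce G (f ` pverts F)"
  let ?h = "\<lparr>iso_verts = f, iso_arcs = map_prod f f, iso_head = snd, iso_tail = fst\<rparr>"
  have "inj_on (map_prod f f) (parcs F)"
    using map_prod_inj_on[OF f(1) f(1)] F.parcs_subset inj_on_subset by blast
  then have "F.digraph_isomorphism ?h"
    using f(1) F.wf_digraph by (auto simp: F.digraph_isomorphism_def)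
  moreover have "with_proj ?H = app_iso ?h (with_proj F)"
    using f(3) F.parcs_subset by (fastforce simp: with_proj_def app_iso_def pinduce_def)
  ultimately have "digraph_iso (with_proj F) (with_proj ?H)"
    unfolding digraph_iso_def by blast
  then have "digraph_iso (with_proj ?H) (with_proj F)"
    using digraph_iso_swap F.wf_digraph by blast
  then show "has_induced_copy G F"
    unfolding has_induced_copy_def induced_subgraph_iff_pinduce using f(2) by blast
qed

section \<open>Added universal vertices\<close>

lemma (in pair_graph) pair_graph_add_universal:
  "w \<notin> pverts G \<Longrightarrow> pair_graph (add_universal w G)"
  using pair_finite_verts parcs_subset sympD[OF symp_adj] irreflpD[OF irreflp_adj]
  by (intro pair_graphI) (auto simp: add_universal_def graph_join_def single_vertex_def)

lemma (in pair_graph) pair_graph_complement: "pair_graph (graph_complement G)"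
  using pair_finite_verts sympD[OF symp_adj]
  by (intro pair_graphI) (auto simp: graph_complement_def)

text \<open>The neighbourhood of \<open>w\<close> is all of \<open>G\<close>, so only the arcs at
  \<open>w\<close> survive unchanged.\<close>

lemma (in pair_graph) local_complement_add_universal:
  "w \<notin> pverts G \<Longrightarrow>
    local_complement (add_universal w G) w = add_universal w (graph_complement G)"
  using parcs_subset
  by (auto simp: local_complement_def add_universal_def graph_join_def single_vertex_def
      graph_complement_def pinduce_def nbhd_def)

lemma pverts_add_universal: "pverts (add_universal w G) = insert w (pverts G)"
  by (simp add: add_universal_def graph_join_def single_vertex_def)

text \<open>The image \<open>x\<close> of \<open>w\<close> is adjacent to the rest of the copy,
  which therefore lies in \<open>nbhd G x\<close>. Conversely, an embedding there extends by sending
  \<open>w\<close> to \<open>x\<close>, which is not its own neighbour.\<close>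

lemma (in pair_graph) embeds_add_universal:
  assumes F: "pair_graph F" and w: "w \<notin> pverts F"
  shows "embeds (\<lambda>u v. (u, v) \<in> parcs G) (pverts G) (add_universal w F) \<longleftrightarrow>
    (\<exists>x\<in>pverts G. embeds (\<lambda>u v. (u, v) \<in> parcs G) (nbhd G x) F)"
proof
  interpret F: pair_graph F by fact
  assume "embeds (\<lambda>u v. (u, v) \<in> parcs G) (pverts G) (add_universal w F)"
  then obtain f where f: "inj_on f (insert w (pverts F))" "f ` insert w (pverts F) \<subseteq> pverts G"
    and arcs: "\<forall>u\<in>insert w (pverts F). \<forall>v\<in>insert w (pverts F).
      (f u, f v) \<in> parcs G \<longleftrightarrow> (u, v) \<in> parcs (add_universal w F)"
    unfolding embeds_def pverts_add_universal by (elim exE conjE) (rule that)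
  have "inj_on f (pverts F)" "f w \<in> pverts G"
    using f(1,2) by auto
  moreover have "f ` pverts F \<subseteq> nbhd G (f w)"
    using arcs by (auto simp: nbhd_def add_universal_def graph_join_def single_vertex_def)
  moreover have "(f u, f v) \<in> parcs G \<longleftrightarrow> (u, v) \<in> parcs F"
    if "u \<in> pverts F" "v \<in> pverts F" for u v
    using arcs that w by (auto simp: add_universal_def graph_join_def single_vertex_def)
  ultimately show "\<exists>x\<in>pverts G. embeds (\<lambda>u v. (u, v) \<in> parcs G) (nbhd G x) F"
    unfolding embeds_def by blast
next
  interpret F: pair_graph F by fact
  assume "\<exists>x\<in>pverts G. embeds (\<lambda>u v. (u, v) \<in> parcs G) (nbhd G x) F"
  then obtain x f where x: "x \<in> pverts G" and f: "inj_on f (pverts F)" "f ` pverts F \<subseteq> nbhd G x"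
    and arcs: "\<forall>u\<in>pverts F. \<forall>v\<in>pverts F. (f u, f v) \<in> parcs G \<longleftrightarrow> (u, v) \<in> parcs F"
    unfolding embeds_def by (elim bexE exE conjE) (rule that)
  define g where "g = f(w := x)"
  have gF: "g u = f u" if "u \<in> pverts F" for u
    using that w by (auto simp: g_def)
  have gw: "g w = x" by (simp add: g_def)
  have xx: "(x, x) \<notin> parcs G"
    using irreflpD[OF irreflp_adj] by blast
  have nb: "(x, f u) \<in> parcs G" "(f u, x) \<in> parcs G" "f u \<noteq> x" if "u \<in> pverts F" for u
    using f(2) that sympD[OF symp_adj] xx by (auto simp: nbhd_def)
  have in_parcs: "(u, v) \<in> parcs (add_universal w F) \<longleftrightarrow>
      (u, v) \<in> parcs F \<or> u \<in> pverts F \<and> v = w \<or> u = w \<and> v \<in> pverts F" for u v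
    by (auto simp: add_universal_def graph_join_def single_vertex_def)
  have ww: "(w, w) \<notin> parcs F"
    using w F.parcs_subset by blast
  have "inj_on g (insert w (pverts F))"
    using f(1) nb gF gw unfolding inj_on_def by (metis insert_iff)
  moreover have "g ` insert w (pverts F) \<subseteq> pverts G"
    using f(2) nbhd_subset x gF gw by auto
  moreover have "\<forall>u\<in>insert w (pverts F). \<forall>v\<in>insert w (pverts F).
      (g u, g v) \<in> parcs G \<longleftrightarrow> (u, v) \<in> parcs (add_universal w F)"
    using arcs nb gF gw w xx in_parcs ww by (simp, blast)
  ultimately show "embeds (\<lambda>u v. (u, v) \<in> parcs G) (pverts G) (add_universal w F)"
    unfolding embeds_def pverts_add_universal by (intro exI[of _ g] conjI)
qed

lemma (in pair_graph) has_induced_copy_add_universal: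
  assumes "pair_graph F" "w \<notin> pverts F"
  shows "has_induced_copy G (add_universal w F) \<longleftrightarrow>
    (\<exists>x\<in>pverts G. embeds (\<lambda>u v. (u, v) \<in> parcs G) (nbhd G x) F)"
  using has_induced_copy_iff_embeds[OF pair_graph.pair_graph_add_universal[OF assms]]
    embeds_add_universal[OF assms] by blast

text \<open>An injective map preserves and reflects distinctness, so the complement can be moved
  from the pattern to the target.\<close>

lemma embeds_graph_complement:
  assumes "irreflp E" "pair_graph F"
  shows "embeds E V (graph_complement F) \<longleftrightarrow> embeds (co_adj E) V F"
proof -
  interpret F: pair_graph F by fact
  have "(E (f u) (f v) \<longleftrightarrow> (u, v) \<in> parcs (graph_complement F)) \<longleftrightarrow>
      (co_adj E (f u) (f v) \<longleftrightarrow> (u, v) \<in> parcs F)"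
    if "inj_on f (pverts F)" "u \<in> pverts F" "v \<in> pverts F" for f u v
    using that irreflpD[OF assms(1)] irreflpD[OF F.irreflp_adj]
    by (auto simp: graph_complement_def co_adj_def dest: inj_onD)
  moreover have "pverts (graph_complement F) = pverts F"
    by (simp add: graph_complement_def)
  ultimately show ?thesis
    unfolding embeds_def
    by (intro arg_cong[where f = Ex] ext conj_cong refl ball_cong) simp_all
qed

section \<open>The concrete forbidden graphs\<close>

lemma embeds_path4_iff:
  assumes "symp E" "irreflp E"
  shows "embeds E V path4 \<longleftrightarrow> P4_in E V"
proof
  have pverts: "pverts path4 = {0, 1, 2, 3}"
    by (simp add: path4_def graph_of_edges_def)
  assume "embeds E V path4"
  then obtain f where f: "f ` {0, 1, 2, 3} \<subseteq> V"
    "\<forall>u\<in>{0, 1, 2, 3}. \<forall>v\<in>{0, 1, 2, 3}. E (f u) (f v) \<longleftrightarrow> (u, v) \<in> parcs path4"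
    unfolding embeds_def pverts by (elim exE conjE) (rule that)
  show "P4_in E V"
    unfolding P4_in_def
    by (rule bexI[of _ "f 0"], rule bexI[of _ "f 1"], rule bexI[of _ "f 2"], rule bexI[of _ "f 3"])
      (use f in \<open>simp_all add: path4_def graph_of_edges_def\<close>)
next
  note s = sympD[OF assms(1)] and i = irreflpD[OF assms(2)]
  assume "P4_in E V"
  then obtain a b c d where
    V: "a \<in> V" "b \<in> V" "c \<in> V" "d \<in> V" and
    E: "E a b" "E b c" "E c d" "\<not> E a c" "\<not> E a d" "\<not> E b d"
    unfolding P4_in_def by blast
  have ne: "a \<noteq> b" "a \<noteq> c" "a \<noteq> d" "b \<noteq> c" "b \<noteq> d" "c \<noteq> d"
    using E s i by metis+
  have E': "E b a" "E c b" "E d c" "\<not> E c a" "\<not> E d a" "\<not> E d b"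
    using E s by blast+
  \<comment> \<open>The vertices of the pattern are 0 to 3, so indexing a list serves as the vertex
    map.\<close>
  show "embeds E V path4"
    unfolding embeds_def
    by (rule exI[of _ "\<lambda>n. [a, b, c, d] ! n"])
      (use V E E' ne i ne[symmetric] in \<open>simp add: path4_def graph_of_edges_def\<close>)
qed

lemma embeds_C4_K1_iff:
  assumes "symp E" "irreflp E"
  shows "embeds E V (graph_union cycle4 (single_vertex 4)) \<longleftrightarrow> C4_K1_in E V"
proof
  have pverts: "pverts (graph_union cycle4 (single_vertex 4)) = {0, 1, 2, 3, 4}"
    by (auto simp: cycle4_def graph_of_edges_def graph_union_def single_vertex_def)
  assume "embeds E V (graph_union cycle4 (single_vertex 4))"
  \<comment> \<open>Injectivity is kept to separate opposite vertices of the cycle, which adjacency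
    alone does not do.\<close>
  then obtain f where f: "inj_on f {0, 1, 2, 3, 4}" "f ` {0, 1, 2, 3, 4} \<subseteq> V"
    "\<forall>u\<in>{0, 1, 2, 3, 4}. \<forall>v\<in>{0, 1, 2, 3, 4}. E (f u) (f v) \<longleftrightarrow> (u, v) \<in> parcs (graph_union cycle4 (single_vertex 4))"
    unfolding embeds_def pverts by (elim exE conjE) (rule that)
  show "C4_K1_in E V"
    unfolding C4_K1_in_def
    by (rule bexI[of _ "f 0"], rule bexI[of _ "f 1"], rule bexI[of _ "f 2"], rule bexI[of _ "f 3"],
        rule bexI[of _ "f 4"])
      (use f in \<open>simp_all add: cycle4_def graph_of_edges_def graph_union_def single_vertex_def\<close>)
next
  note s = sympD[OF assms(1)] and i = irreflpD[OF assms(2)]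
  assume "C4_K1_in E V"
  then obtain a b c d e where
    V: "a \<in> V" "b \<in> V" "c \<in> V" "d \<in> V" "e \<in> V" and
    E: "E a b" "E b c" "E c d" "E d a" "\<not> E a c" "\<not> E b d"
      "\<not> E e a" "\<not> E e b" "\<not> E e c" "\<not> E e d" and ac: "a \<noteq> c" "b \<noteq> d"
    unfolding C4_K1_in_def by blast
  have ne: "a \<noteq> b" "a \<noteq> d" "b \<noteq> c" "c \<noteq> d" "e \<noteq> a" "e \<noteq> b" "e \<noteq> c" "e \<noteq> d"
    using E s i by metis+
  have E': "E b a" "E c b" "E d c" "E a d" "\<not> E c a" "\<not> E d b"
    "\<not> E a e" "\<not> E b e" "\<not> E c e" "\<not> E d e"
    using E s by blast+
  show "embeds E V (graph_union cycle4 (single_vertex 4))"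
    unfolding embeds_def
    by (rule exI[of _ "\<lambda>n. [a, b, c, d, e] ! n"])
      (use V E E' ne ac i ne[symmetric] ac[symmetric] in
        \<open>simp add: cycle4_def graph_of_edges_def graph_union_def single_vertex_def\<close>)
qed

lemma embeds_three_K2_iff:
  assumes "symp E" "irreflp E"
  shows "embeds E V three_K2 \<longleftrightarrow> three_K2_in E V"
proof
  have pverts: "pverts three_K2 = {0, 1, 2, 3, 4, 5}"
    by (simp add: three_K2_def graph_of_edges_def)
  assume "embeds E V three_K2"
  then obtain f where f: "f ` {0, 1, 2, 3, 4, 5} \<subseteq> V"
    "\<forall>u\<in>{0, 1, 2, 3, 4, 5}. \<forall>v\<in>{0, 1, 2, 3, 4, 5}. E (f u) (f v) \<longleftrightarrow> (u, v) \<in> parcs three_K2"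
    unfolding embeds_def pverts by (elim exE conjE) (rule that)
  show "three_K2_in E V"
    unfolding three_K2_in_def
    by (rule bexI[of _ "f 0"], rule bexI[of _ "f 1"], rule bexI[of _ "f 2"], rule bexI[of _ "f 3"],
        rule bexI[of _ "f 4"], rule bexI[of _ "f 5"])
      (use f in \<open>simp_all add: three_K2_def graph_of_edges_def\<close>)
next
  note s = sympD[OF assms(1)] and i = irreflpD[OF assms(2)]
  assume "three_K2_in E V"
  then obtain a b c d e f where
    V: "a \<in> V" "b \<in> V" "c \<in> V" "d \<in> V" "e \<in> V" "f \<in> V" and
    E: "E a b" "E c d" "E e f"
     "\<not> E a c" "\<not> E a d" "\<not> E b c" "\<not> E b d"
     "\<not> E a e" "\<not> E a f" "\<not> E b e" "\<not> E b f"
     "\<not> E c e" "\<not> E c f" "\<not> E d e" "\<not> E d f"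
    unfolding three_K2_in_def by blast
  have ne: "a \<noteq> b" "c \<noteq> d" "e \<noteq> f" "a \<noteq> c" "a \<noteq> d" "b \<noteq> c" "b \<noteq> d"
     "a \<noteq> e" "a \<noteq> f" "b \<noteq> e" "b \<noteq> f" "c \<noteq> e" "c \<noteq> f" "d \<noteq> e" "d \<noteq> f"
    using E s i by metis+
  have E': "E b a" "E d c" "E f e"
     "\<not> E c a" "\<not> E d a" "\<not> E c b" "\<not> E d b"
     "\<not> E e a" "\<not> E f a" "\<not> E e b" "\<not> E f b"
     "\<not> E e c" "\<not> E f c" "\<not> E e d" "\<not> E f d"
    using E s by blast+
  show "embeds E V three_K2"
    unfolding embeds_def
    by (rule exI[of _ "\<lambda>n. [a, b, c, d, e, f] ! n"])
      (use V E E' ne i ne[symmetric] in \<open>simp add: three_K2_def graph_of_edges_def\<close>)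
qed

text \<open>The three parts of the octahedron are the three edges of
  \<open>three_K2\<close>.\<close>

lemma octahedron_eq: "octahedron = graph_complement three_K2"
proof -
  let ?S = "{0, 1, 2, 3, 4, 5} :: nat set"
  note defs = octahedron_def three_K2_def graph_complement_def graph_of_edges_def
  \<comment> \<open>The finitely many pairs in \<open>?S\<close> are evaluated; the next two facts
    confine all arcs to \<open>?S\<close>.\<close>
  have "\<forall>u\<in>?S. \<forall>v\<in>?S. (u, v) \<in> parcs octahedron \<longleftrightarrow> (u, v) \<in> parcs (graph_complement three_K2)"
    by (simp add: defs)
  moreover have "u \<in> ?S \<and> v \<in> ?S" if "(u, v) \<in> parcs octahedron" for u v
    using that unfolding defs by auto
  moreover have "u \<in> ?S \<and> v \<in> ?S" if "(u, v) \<in> parcs (graph_complement three_K2)" for u v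
    using that unfolding defs by simp
  ultimately have "(u, v) \<in> parcs octahedron \<longleftrightarrow> (u, v) \<in> parcs (graph_complement three_K2)" for u v
    by metis
  then have "parcs octahedron = parcs (graph_complement three_K2)"
    by (simp add: set_eq_iff)
  moreover have "pverts octahedron = pverts (graph_complement three_K2)"
    by (simp add: defs)
  ultimately show ?thesis
    by simp
qed

lemma pair_graph_graph_of_edges:
  assumes "finite V" "E \<subseteq> V \<times> V" "\<And>u. (u, u) \<notin> E"
  shows "pair_graph (graph_of_edges V E)"
  using assms by (intro pair_graphI) (auto simp: graph_of_edges_def)

lemma pair_graph_union:
  assumes "pair_graph A" "pair_graph B"
  shows "pair_graph (graph_union A B)"
proof -
  interpret A: pair_graph A + B: pair_graph B
    using assms .
  show ?thesis
    using A.pair_finite_verts A.parcs_subset sympD[OF A.symp_adj] irreflpD[OF A.irreflp_adj]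
      B.pair_finite_verts B.parcs_subset sympD[OF B.symp_adj] irreflpD[OF B.irreflp_adj]
    by (intro pair_graphI) (auto simp: graph_union_def)
qed

lemma pair_graph_single_vertex: "pair_graph (single_vertex u)"
  by (rule pair_graphI) (auto simp: single_vertex_def)

lemma pair_graph_path4: "pair_graph path4"
  unfolding path4_def by (rule pair_graph_graph_of_edges) auto

lemma pair_graph_C4_K1: "pair_graph (graph_union cycle4 (single_vertex 4))"
  unfolding cycle4_def
  by (intro pair_graph_union pair_graph_single_vertex pair_graph_graph_of_edges) auto

lemma pair_graph_three_K2: "pair_graph three_K2"
  unfolding three_K2_def by (rule pair_graph_graph_of_edges) auto

theorem theorem4:
  fixes G :: "'a pair_pre_digraph"
  assumes "pair_graph G"
  shows "good_graph G \<longleftrightarrow>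
    \<not> (\<exists>F \<in> {gem,
              C4_K1_universal,
              local_complement C4_K1_universal 5,
              add_universal 6 three_K2,
              add_universal 6 octahedron}. has_induced_copy G F)"
proof -
  interpret pair_graph G by fact
  let ?E = "\<lambda>u v. (u, v) \<in> parcs G"
  let ?C = "graph_union cycle4 (single_vertex 4)"
  note sym = symp_adj and irr = irreflp_adj
  note co_sym = symp_co_adj[OF sym] and co_irr = irreflp_co_adj[of ?E]
  have new: "4 \<notin> pverts path4" "5 \<notin> pverts ?C" "5 \<notin> pverts (graph_complement ?C)"
    "6 \<notin> pverts three_K2" "6 \<notin> pverts (graph_complement three_K2)"
    by (auto simp: path4_def cycle4_def three_K2_def graph_of_edges_def graph_union_def
        single_vertex_def graph_complement_def)
  note C = pair_graph_C4_K1 and K = pair_graph_three_K2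
  note copy = has_induced_copy_add_universal
  \<comment> \<open>Each forbidden graph is a smaller graph with an added universal vertex, so a
    copy of it means an obstruction in some neighbourhood.\<close>
  have gem: "has_induced_copy G gem \<longleftrightarrow> (\<exists>x\<in>pverts G. P4_in ?E (nbhd G x))"
    unfolding gem_def copy[OF pair_graph_path4 new(1)] embeds_path4_iff[OF sym irr] ..
  have C4_K1: "has_induced_copy G C4_K1_universal \<longleftrightarrow> (\<exists>x\<in>pverts G. C4_K1_in ?E (nbhd G x))"
    unfolding C4_K1_universal_def copy[OF C new(2)] embeds_C4_K1_iff[OF sym irr] ..
  \<comment> \<open>The local complement becomes \<open>graph_complement ?C\<close> with a universal
    vertex; then the complement moves from the pattern to the adjacency.\<close>
  have butterfly: "has_induced_copy G (local_complement C4_K1_universal 5) \<longleftrightarrow>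
      (\<exists>x\<in>pverts G. C4_K1_in (co_adj ?E) (nbhd G x))"
    unfolding C4_K1_universal_def pair_graph.local_complement_add_universal[OF C new(2)]
      copy[OF pair_graph.pair_graph_complement[OF C] new(3)] embeds_graph_complement[OF irr C]
      embeds_C4_K1_iff[OF co_sym co_irr] ..
  have three_K2: "has_induced_copy G (add_universal 6 three_K2) \<longleftrightarrow>
      (\<exists>x\<in>pverts G. three_K2_in ?E (nbhd G x))"
    unfolding copy[OF K new(4)] embeds_three_K2_iff[OF sym irr] ..
  have octahedron: "has_induced_copy G (add_universal 6 octahedron) \<longleftrightarrow>
      (\<exists>x\<in>pverts G. three_K2_in (co_adj ?E) (nbhd G x))"
    unfolding octahedron_eq copy[OF pair_graph.pair_graph_complement[OF K] new(5)]
      embeds_graph_complement[OF irr K] embeds_three_K2_iff[OF co_sym co_irr] ..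
  \<comment> \<open>Both sides now say that no neighbourhood contains an obstruction;
    \<open>bex_simps\<close> splits the five-element set.\<close>
  show ?thesis
    unfolding good_graph_def good_vertex_iff_obstruction_free obstruction_free_def
      bex_simps gem C4_K1 butterfly three_K2 octahedron by blast
qed

end
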